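(* Let $0<\mu<N$ and $p,q\ge 1$, and consider the equation $$-\Delta u(x)=\Big(\int_{\mathbb{R}^N\setminus\{0\}}\frac{|u(y)|^p}{|x-y|^\mu}\,dy\Big)|u(x)|^q,\qquad x\in\mathbb{R}^N\setminus\{0\}.$$ There exists a radially symmetric, positive singular solution $u(x)=\dfrac{A}{|x|^s}$ of this equation, where $$s=\frac{N-\mu+2}{p+q-1}>0\quad\text{and}\quad A^{p+q-1}=\frac{s(N-2-s)\,\gamma(N-2+s(q-1))}{\gamma(N-\mu)\,\gamma(N-sp)}>0,$$ with $0<sp<N$ and $2-N<s(q-1)<2$.
   Context: $N$ is the dimension of the space $\mathbb{R}^N$. For $0<\alpha<N$, $\gamma(\alpha)=\dfrac{2^{\alpha}\pi^{N/2}\,\Gamma(\alpha/2)}{\Gamma((N-\alpha)/2)}$, where $\Gamma(z)=\int_0^{+\infty}t^{z-1}e^{-t}\,dt$ is Euler's Gamma function.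
   Formalization: The positivity of the expression for A^{p+q-1} (equivalently s<N-2) is assumed rather than concluded, since it can fail under the other conditions: N=4, μ=3, p=q=1 gives s=3 and a negative value; the conditions on sp and s(q-1) are also taken as hypotheses. *)

theory Defs
  imports "HOL-Analysis.Analysis"
begin

definition riesz_gamma :: "nat \<Rightarrow> real \<Rightarrow> real" where
  "riesz_gamma N \<alpha> =
     2 powr \<alpha> * pi powr (real N / 2) * Gamma (\<alpha> / 2) / Gamma ((real N - \<alpha>) / 2)"

definition partial :: "'a::euclidean_space \<Rightarrow> ('a \<Rightarrow> real) \<Rightarrow> 'a \<Rightarrow> real" where
  "partial b u x = frechet_derivative u (at x) b"

definition laplacian :: "('a::euclidean_space \<Rightarrow> real) \<Rightarrow> 'a \<Rightarrow> real" where
  "laplacian u x = (\<Sum>b\<in>Basis. partial b (partial b u) x)"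

text \<open>Regularity classes, intended for open \<open>S\<close>.\<close>

definition C1_on :: "'a::euclidean_space set \<Rightarrow> ('a \<Rightarrow> real) \<Rightarrow> bool" where
  "C1_on S u \<longleftrightarrow>
     (\<forall>x\<in>S. u differentiable (at x)) \<and> (\<forall>b\<in>Basis. continuous_on S (partial b u))"

definition C2_on :: "'a::euclidean_space set \<Rightarrow> ('a \<Rightarrow> real) \<Rightarrow> bool" where
  "C2_on S u \<longleftrightarrow> C1_on S u \<and> (\<forall>b\<in>Basis. C1_on S (partial b u))"

text \<open>
  Classical solutions on the punctured space. Integrability is required explicitly because the
  Bochner integral of a non-integrable function is \<open>0\<close>. The totalised value of the integrand at
  \<open>y = x\<close> is irrelevant, a point being a null set.
\<close>

definition choquard_solution ::
  "real \<Rightarrow> real \<Rightarrow> real \<Rightarrow> ('a::euclidean_space \<Rightarrow> real) \<Rightarrow> bool" where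
  "choquard_solution \<mu> p q u \<longleftrightarrow>
     C2_on (UNIV - {0}) u \<and>
     (\<forall>x\<in>UNIV - {0}.
        set_integrable lborel (UNIV - {0}) (\<lambda>y. \<bar>u y\<bar> powr p / norm (x - y) powr \<mu>) \<and>
        - laplacian u x =
          (LINT y:UNIV - {0}|lborel. \<bar>u y\<bar> powr p / norm (x - y) powr \<mu>) * \<bar>u x\<bar> powr q)"

definition radially_symmetric :: "('a::euclidean_space \<Rightarrow> real) \<Rightarrow> bool" where
  "radially_symmetric u \<longleftrightarrow>
     (\<forall>x\<in>UNIV - {0}. \<forall>y\<in>UNIV - {0}. norm x = norm y \<longrightarrow> u x = u y)"

definition positive_off_origin :: "('a::euclidean_space \<Rightarrow> real) \<Rightarrow> bool" where
  "positive_off_origin u \<longleftrightarrow> (\<forall>x\<in>UNIV - {0}. 0 < u x)"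

definition singular_at_origin :: "('a::euclidean_space \<Rightarrow> real) \<Rightarrow> bool" where
  "singular_at_origin u \<longleftrightarrow> filterlim u at_top (at 0)"

end

theory Submission
  imports Defs "HOL-Probability.Distributions" "HOL-Real_Asymp.Real_Asymp"
begin

text \<open>
  For a power \<open>u = A |x|^(-s)\<close> both sides of the equation are multiples of \<open>|x|^(-s-2)\<close>: the left side by
  direct differentiation, the right side by Riesz's composition formula
  \<open>\<integral> |y|^(-a) |x - y|^(-b) dy = C |x|^(N-a-b)\<close> with \<open>a = s p\<close>, \<open>b = \<mu>\<close>; comparing constants determines \<open>A\<close>.
  The bounds on \<open>s (q - 1)\<close> say exactly that \<open>N < a + b < 2 N\<close>.
  The composition formula follows by writing each kernel as a superposition of Gaussians,
  \<open>\<Gamma>(a/2) |y|^(-a) = \<integral> t^(a/2-1) exp (- t |y|\<^sup>2) dt\<close> over \<open>t > 0\<close>, integrating in \<open>y\<close> first by completing the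
  square, and then substituting \<open>v \<rightarrow> t v\<close> in the second parameter, which
  separates the remaining double integral into a Gamma and a Beta integral. All integrands are
  nonnegative, so Tonelli's theorem suffices and integrability comes for free.
\<close>

section \<open>Gamma and Beta integrals over the half-line\<close>

text \<open>Euler's integral after the substitution \<open>t -> c * t\<close>. With \<open>c\<close>
  a squared norm and \<open>z\<close> half an exponent, it writes a Riesz kernel as a superposition
  of Gaussians.\<close>

lemma nn_integral_gamma_kernel:
  fixes c z :: real
  assumes "0 < c" "0 < z"
  shows "(\<integral>\<^sup>+t. ennreal (indicator {0<..} t * t powr (z - 1) * exp (- (t * c))) \<partial>lborel) =
    ennreal (Gamma z * c powr (- z))"
proof -
  let ?f = "\<lambda>t::real. ennreal (indicator {0..} t * t powr (z - 1) / exp t)"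
  let ?g = "\<lambda>t::real. ennreal (indicator {0<..} t * t powr (z - 1) * exp (- (t * c)))"
  have "ennreal (Gamma z) = (\<integral>\<^sup>+t. ?f t \<partial>lborel)"
    using Gamma_conv_nn_integral_real[OF assms(2)] .
  also have "\<dots> = \<bar>c\<bar> * (\<integral>\<^sup>+t. ?f (0 + c * t) \<partial>lborel)"
    by (rule nn_integral_real_affine, measurable) (use assms in simp)
  also have "(\<integral>\<^sup>+t. ?f (0 + c * t) \<partial>lborel) = (\<integral>\<^sup>+t. ennreal (c powr (z - 1)) * ?g t \<partial>lborel)"
  proof (rule nn_integral_cong)
    fix t :: real
    \<comment> \<open>The indicators differ only at \<open>t = 0\<close>, where
      \<open>0 powr (z - 1) = 0\<close> makes both sides vanish.\<close>
    have "indicator {0..} (c * t) * (c * t) powr (z - 1) / exp (c * t) =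
        c powr (z - 1) * (indicator {0<..} t * t powr (z - 1) * exp (- (t * c)))"
      using assms by (cases "t = 0")
        (auto simp: indicator_def powr_mult zero_le_mult_iff exp_minus field_simps)
    thus "?f (0 + c * t) = ennreal (c powr (z - 1)) * ?g t"
      by (simp add: ennreal_mult'[symmetric])
  qed
  also have "\<dots> = ennreal (c powr (z - 1)) * (\<integral>\<^sup>+t. ?g t \<partial>lborel)"
    by (rule nn_integral_cmult) measurable
  finally have eq: "ennreal (Gamma z) = ennreal (c powr z) * (\<integral>\<^sup>+t. ?g t \<partial>lborel)"
    using assms by (simp add: mult.assoc[symmetric] ennreal_mult'[symmetric] powr_diff)
  \<comment> \<open>\<open>ennreal\<close> is not a field, so the finite positive factor
    \<open>c powr z\<close> is cancelled by inserting its reciprocal, formed in the reals.\<close>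
  have "(\<integral>\<^sup>+t. ?g t \<partial>lborel) = ennreal (c powr (- z) * c powr z) * (\<integral>\<^sup>+t. ?g t \<partial>lborel)"
    using assms by (simp add: powr_minus)
  also have "\<dots> = ennreal (c powr (- z)) * ennreal (Gamma z)"
    by (simp add: eq mult.assoc ennreal_mult')
  finally show ?thesis
    using assms by (simp add: ennreal_mult'[symmetric] mult.commute)
qed

text \<open>The Jacobian \<open>t\<close> stays inside \<open>ennreal\<close>, so that the
  integrands before and after scaling can be compared as real numbers.\<close>

lemma nn_integral_scale_pos:
  fixes t :: real and f :: "real \<Rightarrow> real"
  assumes [measurable]: "f \<in> borel_measurable borel" and "0 < t"
  shows "(\<integral>\<^sup>+v. ennreal (f v) \<partial>lborel) = (\<integral>\<^sup>+v. ennreal (t * f (t * v)) \<partial>lborel)"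
proof -
  have "(\<integral>\<^sup>+v. ennreal (f v) \<partial>lborel) = \<bar>t\<bar> * (\<integral>\<^sup>+v. ennreal (f (0 + t * v)) \<partial>lborel)"
    by (rule nn_integral_real_affine) (use assms in auto)
  also have "\<dots> = (\<integral>\<^sup>+v. ennreal t * ennreal (f (t * v)) \<partial>lborel)"
    using assms by (subst nn_integral_cmult) auto
  finally show ?thesis using assms by (simp add: ennreal_mult')
qed

text \<open>Write \<open>Gamma x * Gamma y\<close> as a double integral and scale
  \<open>v -> t * v\<close>. The exponentials merge into \<open>exp (- (t * (1 + v)))\<close>, and
  integrating over \<open>t\<close> first gives
  \<open>Gamma (x + y) * (1 + v) powr (- (x + y))\<close>. This half-line form of the Beta integral
  is the one that the composition formula produces.\<close>

lemma nn_integral_beta_kernel: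
  fixes x y :: real
  assumes "0 < x" "0 < y"
  shows "(\<integral>\<^sup>+v. ennreal (indicator {0<..} v * v powr (x - 1) * (1 + v) powr (- (x + y))) \<partial>lborel) =
    ennreal (Gamma x * Gamma y / Gamma (x + y))" (is "?B = _")
proof -
  define P where "P = (\<lambda>z t::real. indicator {0<..} t * t powr (z - 1) :: real)"
  have P_meas [measurable]: "P z \<in> borel_measurable borel" for z
    unfolding P_def by measurable
  have P_nonneg: "0 \<le> P z t" for z t
    by (simp add: P_def)
  have gam: "(\<integral>\<^sup>+t. ennreal (P z t * exp (- (t * c))) \<partial>lborel) = ennreal (Gamma z * c powr (- z))"
    if "0 < c" "0 < z" for c z
    using nn_integral_gamma_kernel[OF that] by (simp add: P_def)
  have "ennreal (Gamma x * Gamma y) =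
      (\<integral>\<^sup>+t. ennreal (P y t * exp (- t)) * ennreal (Gamma x) \<partial>lborel)"
    using gam[of 1 y] assms by (subst nn_integral_multc) (auto simp: ennreal_mult'[symmetric] mult.commute)
  also have "\<dots> = (\<integral>\<^sup>+t. \<integral>\<^sup>+v. ennreal (P y t * exp (- t)) * ennreal (P x v * exp (- v)) \<partial>lborel \<partial>lborel)"
    using gam[of 1 x] assms by (subst nn_integral_cmult) auto
  also have "\<dots> = (\<integral>\<^sup>+t. \<integral>\<^sup>+v. ennreal (P x v * (P (x + y) t * exp (- (t * (1 + v))))) \<partial>lborel \<partial>lborel)"
  proof (rule nn_integral_cong)
    fix t :: real
    show "(\<integral>\<^sup>+v. ennreal (P y t * exp (- t)) * ennreal (P x v * exp (- v)) \<partial>lborel) =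
      (\<integral>\<^sup>+v. ennreal (P x v * (P (x + y) t * exp (- (t * (1 + v))))) \<partial>lborel)"
    proof (cases "0 < t")
      case True
      have "(\<integral>\<^sup>+v. ennreal (P y t * exp (- t) * (P x v * exp (- v))) \<partial>lborel) =
        (\<integral>\<^sup>+v. ennreal (t * (P y t * exp (- t) * (P x (t * v) * exp (- (t * v))))) \<partial>lborel)"
        by (rule nn_integral_scale_pos) (use True in measurable)
      also have "\<dots> = (\<integral>\<^sup>+v. ennreal (P x v * (P (x + y) t * exp (- (t * (1 + v))))) \<partial>lborel)"
      proof (rule nn_integral_cong, rule arg_cong[where f = ennreal])
        fix v :: real
        \<comment> \<open>The Jacobian and the scaled weight of \<open>v\<close> raise the exponent
          of \<open>t\<close> from \<open>y - 1\<close> to \<open>x + y - 1\<close>.\<close>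
        have "t * (t powr (y - 1) * t powr (x - 1)) = t powr (x + y - 1)"
          using True by (simp add: powr_add[symmetric] powr_mult_base add.commute)
        thus "t * (P y t * exp (- t) * (P x (t * v) * exp (- (t * v)))) =
          P x v * (P (x + y) t * exp (- (t * (1 + v))))"
          using True by (auto simp: P_def indicator_def powr_mult zero_less_mult_iff
              ring_distribs exp_add exp_diff exp_minus field_simps)
      qed
      finally show ?thesis
        by (simp add: ennreal_mult' P_nonneg)
    qed (simp add: P_def)
  qed
  also have "\<dots> = (\<integral>\<^sup>+v. \<integral>\<^sup>+t. ennreal (P x v * (P (x + y) t * exp (- (t * (1 + v))))) \<partial>lborel \<partial>lborel)"
    by (rule lborel_pair.Fubini') measurable
  also have "\<dots> = (\<integral>\<^sup>+v. ennreal (Gamma (x + y)) * ennreal (P x v * (1 + v) powr (- (x + y))) \<partial>lborel)"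
  proof (rule nn_integral_cong)
    fix v :: real
    show "(\<integral>\<^sup>+t. ennreal (P x v * (P (x + y) t * exp (- (t * (1 + v))))) \<partial>lborel) =
      ennreal (Gamma (x + y)) * ennreal (P x v * (1 + v) powr (- (x + y)))"
    proof (cases "0 < v")
      case True
      have "(\<integral>\<^sup>+t. ennreal (P x v * (P (x + y) t * exp (- (t * (1 + v))))) \<partial>lborel) =
        ennreal (P x v) * (\<integral>\<^sup>+t. ennreal (P (x + y) t * exp (- (t * (1 + v)))) \<partial>lborel)"
        by (simp add: ennreal_mult' P_nonneg nn_integral_cmult)
      thus ?thesis
        using True assms by (simp add: gam ennreal_mult'[symmetric] P_nonneg mult_ac)
    qed (simp add: P_def)
  qed
  also have "\<dots> = ennreal (Gamma (x + y)) * ?B"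
    by (subst nn_integral_cmult) (auto simp: P_def)
  finally have eq: "ennreal (Gamma x * Gamma y) = ennreal (Gamma (x + y)) * ?B" .
  have pos: "0 < Gamma (x + y)"
    using assms by (intro Gamma_real_pos) auto
  have "?B = ennreal (1 / Gamma (x + y) * Gamma (x + y)) * ?B"
    using pos by simp
  also have "\<dots> = ennreal (1 / Gamma (x + y)) * ennreal (Gamma x * Gamma y)"
    unfolding eq using pos by (subst ennreal_mult') (simp_all add: mult.assoc)
  finally show ?thesis
    using pos by (simp add: ennreal_mult'[symmetric])
qed

section \<open>Gaussian integrals\<close>

text \<open>Normalisation of the normal density with variance \<open>1 / (2 * c)\<close>, the choice
  that makes its exponent \<open>- (c * x\<^sup>2)\<close>.\<close>

lemma nn_integral_gaussian_1d:
  fixes c :: real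
  assumes "0 < c"
  shows "(\<integral>\<^sup>+x. ennreal (exp (- (c * x\<^sup>2))) \<partial>lborel) = ennreal (sqrt (pi / c))"
proof -
  have eq: "normal_density 0 (1 / sqrt (2 * c)) x = sqrt (c / pi) * exp (- (c * x\<^sup>2))" for x
    using assms by (simp add: normal_density_def power_divide real_sqrt_divide)
  have "ennreal 1 = (\<integral>\<^sup>+x. ennreal (normal_density 0 (1 / sqrt (2 * c)) x) \<partial>lborel)"
    using assms by (subst nn_integral_eq_integral) auto
  also have "\<dots> = ennreal (sqrt (c / pi)) * (\<integral>\<^sup>+x. ennreal (exp (- (c * x\<^sup>2))) \<partial>lborel)"
    using assms unfolding eq by (simp add: ennreal_mult' nn_integral_cmult)
  finally have 1: "ennreal 1 = ennreal (sqrt (c / pi)) * (\<integral>\<^sup>+x. ennreal (exp (- (c * x\<^sup>2))) \<partial>lborel)" .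
  have "ennreal (sqrt (pi / c)) * ennreal 1 =
      ennreal (sqrt (pi / c) * sqrt (c / pi)) * (\<integral>\<^sup>+x. ennreal (exp (- (c * x\<^sup>2))) \<partial>lborel)"
    using assms by (simp only: 1 ennreal_mult' mult.assoc real_sqrt_ge_zero divide_nonneg_nonneg less_imp_le pi_ge_zero)
  also have "sqrt (pi / c) * sqrt (c / pi) = 1"
    using assms by (simp add: real_sqrt_mult[symmetric])
  finally show ?thesis by simp
qed

text \<open>The Gaussian factors over the coordinates, so its integral is a product of equal
  one-dimensional integrals.\<close>

lemma nn_integral_gaussian:
  fixes c :: real
  assumes "0 < c"
  shows "(\<integral>\<^sup>+x. ennreal (exp (- (c * (norm (x :: 'a::euclidean_space))\<^sup>2))) \<partial>lborel) =
    ennreal ((pi / c) powr (DIM('a) / 2))"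
proof -
  have "ennreal (exp (- (c * (norm x)\<^sup>2))) = (\<Prod>b\<in>Basis. ennreal (exp (- (c * (x \<bullet> b)\<^sup>2))))" for x :: 'a
  proof -
    have "(norm x)\<^sup>2 = (\<Sum>b\<in>Basis. (x \<bullet> b)\<^sup>2)"
      by (subst power2_norm_eq_inner, subst euclidean_inner) (simp add: power2_eq_square)
    thus ?thesis
      by (simp add: prod_ennreal sum_distrib_left exp_sum sum_negf[symmetric])
  qed
  hence "(\<integral>\<^sup>+x. ennreal (exp (- (c * (norm (x :: 'a))\<^sup>2))) \<partial>lborel) = (\<Prod>b\<in>(Basis::'a set). ennreal (sqrt (pi / c)))"
    using nn_integral_lborel_prod[of "(\<lambda>_ x. ennreal (exp (- (c * x\<^sup>2)))) :: 'a \<Rightarrow> real \<Rightarrow> ennreal"]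
    by (simp add: nn_integral_gaussian_1d[OF assms])
  also have "\<dots> = ennreal (sqrt (pi / c) ^ DIM('a))"
    by (simp add: ennreal_power assms less_imp_le)
  also have "sqrt (pi / c) ^ DIM('a) = (pi / c) powr (DIM('a) / 2)"
    using assms by (simp add: powr_half_sqrt[symmetric] powr_realpow[symmetric] powr_powr)
  finally show ?thesis .
qed

text \<open>Completing the square: the exponent is a quadratic in \<open>y\<close> with its minimum
  at the weighted mean \<open>z\<close> of \<open>0\<close> and \<open>x\<close>. Translating by
  \<open>z\<close> leaves a centred Gaussian of parameter \<open>t + v\<close> and a factor
  \<open>D\<close> free of \<open>y\<close>.\<close>

lemma nn_integral_gaussian_product:
  fixes t v :: real and x :: "'a::euclidean_space"
  assumes "0 < t" "0 < v"
  shows "(\<integral>\<^sup>+y. ennreal (exp (- (t * (norm y)\<^sup>2 + v * (norm (x - y))\<^sup>2))) \<partial>lborel) =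
    ennreal ((pi / (t + v)) powr (DIM('a) / 2) * exp (- (t * v / (t + v) * (norm x)\<^sup>2)))"
proof -
  define z where "z = (v / (t + v)) *\<^sub>R x"
  define D where "D = exp (- (t * v / (t + v) * (norm x)\<^sup>2))"
  have sq: "t * (norm (z + y))\<^sup>2 + v * (norm (x - (z + y)))\<^sup>2 = (t + v) * (norm y)\<^sup>2 + t * v / (t + v) * (norm x)\<^sup>2" for y
  proof -
    \<comment> \<open>In these inner products the identity is polynomial;
      \<open>k * (t + v) = v\<close> cancels the mixed terms in \<open>W\<close>.\<close>
    define X Y W where "X = x \<bullet> x" and "Y = y \<bullet> y" and "W = x \<bullet> y"
    define k where "k = v / (t + v)"
    have 1: "t * (norm (z + y))\<^sup>2 + v * (norm (x - (z + y)))\<^sup>2 =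
      t * (k * k * X + 2 * k * W + Y) + v * (X - 2 * (k * X + W) + k * k * X + 2 * k * W + Y)"
      unfolding power2_norm_eq_inner z_def k_def[symmetric] X_def Y_def W_def
      by (simp add: inner_simps inner_commute algebra_simps)
    have k: "k * (t + v) = v" using assms by (simp add: k_def)
    have "t * (k * k * X + 2 * k * W + Y) + v * (X - 2 * (k * X + W) + k * k * X + 2 * k * W + Y) =
      (k * (t + v)) * (k * X) + 2 * (k * (t + v)) * W + (t + v) * Y + v * X - 2 * v * k * X - 2 * v * W"
      by algebra
    also have "\<dots> = (t + v) * Y + v * (1 - k) * X"
      unfolding k by algebra
    also have "v * (1 - k) = t * v / (t + v)"
      using assms by (simp add: k_def field_simps)
    finally show ?thesis unfolding 1 by (simp add: X_def Y_def power2_norm_eq_inner)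
  qed
  have "(\<integral>\<^sup>+y. ennreal (exp (- (t * (norm y)\<^sup>2 + v * (norm (x - y))\<^sup>2))) \<partial>lborel) =
    (\<integral>\<^sup>+y. ennreal (exp (- (t * (norm y)\<^sup>2 + v * (norm (x - y))\<^sup>2))) \<partial>(distr lborel borel ((+) z)))"
    by (simp add: lborel_distr_plus)
  also have "\<dots> = (\<integral>\<^sup>+y. ennreal (exp (- ((t + v) * (norm (y :: 'a))\<^sup>2))) * ennreal D \<partial>lborel)"
    by (subst nn_integral_distr)
      (simp_all add: sq D_def exp_diff exp_minus exp_add ennreal_mult'[symmetric] divide_inverse)
  also have "\<dots> = ennreal ((pi / (t + v)) powr (DIM('a) / 2)) * ennreal D"
    using assms by (subst nn_integral_multc) (simp_all add: nn_integral_gaussian)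
  finally show ?thesis by (simp add: D_def ennreal_mult')
qed


section \<open>Riesz's composition formula\<close>

text \<open>The conditions \<open>a < DIM('a)\<close> and \<open>b < DIM('a)\<close> reflect local
  integrability at \<open>0\<close> and at \<open>x\<close>, and \<open>DIM('a) < a + b\<close>
  reflects decay at infinity. In the proof they make the arguments of the three Gamma factors in the
  numerator positive.\<close>

lemma nn_integral_riesz_kernels:
  fixes a b :: real and x :: "'a::euclidean_space"
  assumes a: "0 < a" "a < DIM('a)" and b: "0 < b" "b < DIM('a)" and ab: "DIM('a) < a + b"
    and x: "x \<noteq> 0"
  shows "(\<integral>\<^sup>+y. ennreal (norm y powr (- a) * norm (x - y) powr (- b)) \<partial>lborel) =
    ennreal (pi powr (DIM('a) / 2) *
      (Gamma ((DIM('a) - a) / 2) * Gamma ((DIM('a) - b) / 2) * Gamma ((a + b - DIM('a)) / 2)) /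
      (Gamma (a / 2) * Gamma (b / 2) * Gamma (DIM('a) - (a + b) / 2)) *
      norm x powr (DIM('a) - a - b))" (is "?J = _")
proof -
  define n where "n = real DIM('a)"
  \<comment> \<open>\<open>c\<close> is the exponent of the Gamma integral that remains in
    \<open>t\<close>; \<open>\<beta> - c = (n - a) / 2\<close> and
    \<open>\<alpha> - c = (n - b) / 2\<close> are the parameters of the Beta integral in
    \<open>v\<close>.\<close>
  define \<alpha> \<beta> c where "\<alpha> = a / 2" and "\<beta> = b / 2" and "c = (a + b - n) / 2"
  have pos: "0 < \<alpha>" "0 < \<beta>" "0 < c" "0 < \<beta> - c" "0 < \<alpha> - c"
    using a b ab by (auto simp: \<alpha>_def \<beta>_def c_def n_def)
  have n: "n / 2 = \<alpha> + \<beta> - c"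
    by (simp add: \<alpha>_def \<beta>_def c_def field_simps)
  define r where "r = (norm x)\<^sup>2"
  have r: "0 < r" using x by (simp add: r_def)
  define P where "P = (\<lambda>z t::real. indicator {0<..} t * t powr (z - 1) :: real)"
  have P_meas [measurable]: "P z \<in> borel_measurable borel" for z
    unfolding P_def by measurable
  have P_nonneg: "0 \<le> P z t" for z t
    by (simp add: P_def)
  have gam: "(\<integral>\<^sup>+t. ennreal (P z t * exp (- (t * c))) \<partial>lborel) = ennreal (Gamma z * c powr (- z))"
    if "0 < c" "0 < z" for c z
    using nn_integral_gamma_kernel[OF that] by (simp add: P_def)
  define G where "G = Gamma \<alpha> * Gamma \<beta>"
  have G: "0 < G" using pos by (simp add: G_def Gamma_real_pos)
  have norm_powr: "(norm y)\<^sup>2 powr (- z) = norm y powr (- (2 * z))" for z and y :: 'a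
  proof -
    have "(norm y)\<^sup>2 = norm y powr 2" by simp
    thus ?thesis by (simp only: powr_powr) simp
  qed

  \<comment> \<open>Multiplying by \<open>G\<close> supplies each kernel with the Gamma factor of
    its Gaussian superposition.\<close>
  have "ennreal G * ?J =
      (\<integral>\<^sup>+y. ennreal (Gamma \<alpha> * norm y powr (- a)) * ennreal (Gamma \<beta> * norm (x - y) powr (- b)) \<partial>lborel)"
  proof (subst nn_integral_cmult[symmetric], measurable, rule nn_integral_cong)
    fix y :: 'a
    have "0 \<le> Gamma \<alpha>" "0 \<le> G"
      using pos G by (auto intro: Gamma_real_pos less_imp_le)
    thus "ennreal G * ennreal (norm y powr (- a) * norm (x - y) powr (- b)) =
      ennreal (Gamma \<alpha> * norm y powr (- a)) * ennreal (Gamma \<beta> * norm (x - y) powr (- b))"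
      by (simp only: ennreal_mult'[symmetric] mult_nonneg_nonneg powr_ge_zero G_def) (simp only: mult_ac)
  qed
  also have "\<dots> = (\<integral>\<^sup>+y. (\<integral>\<^sup>+t. \<integral>\<^sup>+v. ennreal (P \<alpha> t * P \<beta> v *
      exp (- (t * (norm y)\<^sup>2 + v * (norm (x - y))\<^sup>2))) \<partial>lborel \<partial>lborel) \<partial>lborel)"
  \<comment> \<open>The superposition fails at \<open>y = 0\<close> and \<open>y = x\<close>: there
    one of the Gamma integrals diverges, while \<open>powr\<close> at base \<open>0\<close> returns
    \<open>0\<close>. These two points form a null set.\<close>
  proof (rule nn_integral_cong_AE)
    have "AE y in lborel. y \<noteq> 0 \<and> y \<noteq> x"
      using AE_lborel_singleton[of 0] AE_lborel_singleton[of x] by eventually_elim auto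
    thus "AE y in lborel. ennreal (Gamma \<alpha> * norm y powr (- a)) * ennreal (Gamma \<beta> * norm (x - y) powr (- b)) =
      (\<integral>\<^sup>+t. \<integral>\<^sup>+v. ennreal (P \<alpha> t * P \<beta> v *
        exp (- (t * (norm y)\<^sup>2 + v * (norm (x - y))\<^sup>2))) \<partial>lborel \<partial>lborel)"
    proof eventually_elim
      case (elim y)
      have 1: "ennreal (Gamma \<alpha> * norm y powr (- a)) = (\<integral>\<^sup>+t. ennreal (P \<alpha> t * exp (- (t * (norm y)\<^sup>2))) \<partial>lborel)"
        using elim pos gam[of "(norm y)\<^sup>2" \<alpha>] by (simp add: norm_powr) (simp add: \<alpha>_def)
      have 2: "ennreal (Gamma \<beta> * norm (x - y) powr (- b)) = (\<integral>\<^sup>+v. ennreal (P \<beta> v * exp (- (v * (norm (x - y))\<^sup>2))) \<partial>lborel)"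
        using elim[THEN conjunct2, symmetric] pos gam[of "(norm (x - y))\<^sup>2" \<beta>] by (simp add: norm_powr) (simp add: \<beta>_def)
      have "ennreal (Gamma \<alpha> * norm y powr (- a)) * ennreal (Gamma \<beta> * norm (x - y) powr (- b)) =
        (\<integral>\<^sup>+t. ennreal (P \<alpha> t * exp (- (t * (norm y)\<^sup>2))) * ennreal (Gamma \<beta> * norm (x - y) powr (- b)) \<partial>lborel)"
        unfolding 1 by (rule nn_integral_multc[symmetric]) measurable
      also have "\<dots> = (\<integral>\<^sup>+t. \<integral>\<^sup>+v. ennreal (P \<alpha> t * exp (- (t * (norm y)\<^sup>2))) *
          ennreal (P \<beta> v * exp (- (v * (norm (x - y))\<^sup>2))) \<partial>lborel \<partial>lborel)"
        unfolding 2 by (intro nn_integral_cong nn_integral_cmult[symmetric]) measurable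
      finally show ?case
        by (simp add: ennreal_mult'[symmetric] P_nonneg exp_add exp_diff exp_minus divide_inverse mult_ac)
    qed
  qed
  \<comment> \<open>Two uses of Tonelli move the \<open>y\<close> integral innermost, first past
    \<open>t\<close> and then past \<open>v\<close>.\<close>
  also have "\<dots> = (\<integral>\<^sup>+t. \<integral>\<^sup>+y. (\<integral>\<^sup>+v. ennreal (P \<alpha> t * P \<beta> v *
      exp (- (t * (norm y)\<^sup>2 + v * (norm (x - y))\<^sup>2))) \<partial>lborel) \<partial>lborel \<partial>lborel)"
    by (rule lborel_pair.Fubini') measurable
  also have "\<dots> = (\<integral>\<^sup>+t. \<integral>\<^sup>+v. (\<integral>\<^sup>+y. ennreal (P \<alpha> t * P \<beta> v *
      exp (- (t * (norm y)\<^sup>2 + v * (norm (x - y))\<^sup>2))) \<partial>lborel) \<partial>lborel \<partial>lborel)"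
    by (intro nn_integral_cong lborel_pair.Fubini') measurable
  also have "\<dots> = (\<integral>\<^sup>+t. \<integral>\<^sup>+v. ennreal (P \<alpha> t * P \<beta> v *
      ((pi / (t + v)) powr (n / 2) * exp (- (t * v / (t + v) * r)))) \<partial>lborel \<partial>lborel)"
  proof (intro nn_integral_cong)
    fix t v :: real
    show "(\<integral>\<^sup>+y. ennreal (P \<alpha> t * P \<beta> v * exp (- (t * (norm y)\<^sup>2 + v * (norm (x - y))\<^sup>2))) \<partial>lborel) =
      ennreal (P \<alpha> t * P \<beta> v * ((pi / (t + v)) powr (n / 2) * exp (- (t * v / (t + v) * r))))"
    proof (cases "0 < t \<and> 0 < v")
      case True
      have "(\<integral>\<^sup>+y. ennreal (P \<alpha> t * P \<beta> v * exp (- (t * (norm y)\<^sup>2 + v * (norm (x - y))\<^sup>2))) \<partial>lborel) =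
        ennreal (P \<alpha> t * P \<beta> v) * (\<integral>\<^sup>+y. ennreal (exp (- (t * (norm y)\<^sup>2 + v * (norm (x - y))\<^sup>2))) \<partial>lborel)"
        by (subst nn_integral_cmult[symmetric]) (auto simp: ennreal_mult'[symmetric] P_nonneg)
      also have "\<dots> = ennreal (P \<alpha> t * P \<beta> v) *
          ennreal ((pi / (t + v)) powr (n / 2) * exp (- (t * v / (t + v) * r)))"
        using True by (simp only: nn_integral_gaussian_product n_def r_def)
      finally show ?thesis
        by (simp add: ennreal_mult'[symmetric] P_nonneg)
    qed (auto simp: P_def)
  qed
  \<comment> \<open>After scaling \<open>v -> t * v\<close>, the quotient
    \<open>t * v / (t + v)\<close> becomes \<open>t * (v / (1 + v))\<close>. The exponent is now
    linear in \<open>t\<close>, and the other factors split into a function of \<open>t\<close>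
    times a function of \<open>v\<close>.\<close>
  also have "\<dots> = (\<integral>\<^sup>+t. \<integral>\<^sup>+v. ennreal (pi powr (n / 2) * P \<beta> v * (1 + v) powr (- (n / 2)) *
      (P c t * exp (- (t * (v * r / (1 + v)))))) \<partial>lborel \<partial>lborel)"
  proof (rule nn_integral_cong)
    fix t :: real
    show "(\<integral>\<^sup>+v. ennreal (P \<alpha> t * P \<beta> v *
        ((pi / (t + v)) powr (n / 2) * exp (- (t * v / (t + v) * r)))) \<partial>lborel) =
      (\<integral>\<^sup>+v. ennreal (pi powr (n / 2) * P \<beta> v * (1 + v) powr (- (n / 2)) *
        (P c t * exp (- (t * (v * r / (1 + v)))))) \<partial>lborel)"
    proof (cases "0 < t")
      case True
      have "(\<integral>\<^sup>+v. ennreal (P \<alpha> t * P \<beta> v *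
          ((pi / (t + v)) powr (n / 2) * exp (- (t * v / (t + v) * r)))) \<partial>lborel) =
        (\<integral>\<^sup>+v. ennreal (t * (P \<alpha> t * P \<beta> (t * v) *
          ((pi / (t + t * v)) powr (n / 2) * exp (- (t * (t * v) / (t + t * v) * r))))) \<partial>lborel)"
        by (rule nn_integral_scale_pos, measurable) (use True in simp)
      also have "\<dots> = (\<integral>\<^sup>+v. ennreal (pi powr (n / 2) * P \<beta> v * (1 + v) powr (- (n / 2)) *
        (P c t * exp (- (t * (v * r / (1 + v)))))) \<partial>lborel)"
      proof (rule nn_integral_cong, rule arg_cong[where f = ennreal])
        fix v :: real
        show "t * (P \<alpha> t * P \<beta> (t * v) *
            ((pi / (t + t * v)) powr (n / 2) * exp (- (t * (t * v) / (t + t * v) * r)))) =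
          pi powr (n / 2) * P \<beta> v * (1 + v) powr (- (n / 2)) *
            (P c t * exp (- (t * (v * r / (1 + v)))))"
        proof (cases "0 < v")
          case v: True
          have sum: "t + t * v = t * (1 + v)" by (simp add: ring_distribs)
          have e: "t * (t * v) / (t + t * v) * r = t * (v * r / (1 + v))"
            unfolding sum using True by simp
          \<comment> \<open>Counting powers of \<open>t\<close>: the Jacobian, both weights and the
            Gaussian normalisation give
            \<open>1 + (\<alpha> - 1) + (\<beta> - 1) - n / 2 = c - 1\<close>.\<close>
          have "t powr c = t * (t powr (\<alpha> - 1) * t powr (\<beta> - 1) * t powr (- (n / 2))) * t"
            using True by (simp add: powr_add[symmetric] powr_mult_base n mult.commute)
          hence 1: "t * (t powr (\<alpha> - 1) * t powr (\<beta> - 1) * t powr (- (n / 2))) = t powr (c - 1)"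
            using True by (simp add: powr_diff)
          have 2: "(pi / (t + t * v)) powr (n / 2) =
              pi powr (n / 2) * t powr (- (n / 2)) * (1 + v) powr (- (n / 2))"
          proof -
            have "(pi / (t * (1 + v))) powr (n / 2) = pi powr (n / 2) / (t powr (n / 2) * (1 + v) powr (n / 2))"
              using True v by (simp only: powr_divide powr_mult)
            thus ?thesis
              unfolding sum powr_minus_divide by simp
          qed
          have 3: "P \<alpha> t = t powr (\<alpha> - 1)" "P \<beta> (t * v) = t powr (\<beta> - 1) * v powr (\<beta> - 1)"
              "P \<beta> v = v powr (\<beta> - 1)" "P c t = t powr (c - 1)"
            using True v by (simp_all add: P_def powr_mult)
          show ?thesis
            unfolding e 2 3 1[symmetric] by (simp only: mult_ac)
        qed (use True in \<open>auto simp: P_def zero_less_mult_iff\<close>)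
      qed
      finally show ?thesis .
    qed (simp add: P_def)
  qed
  also have "\<dots> = (\<integral>\<^sup>+v. \<integral>\<^sup>+t. ennreal (pi powr (n / 2) * P \<beta> v * (1 + v) powr (- (n / 2)) *
      (P c t * exp (- (t * (v * r / (1 + v)))))) \<partial>lborel \<partial>lborel)"
    by (rule lborel_pair.Fubini') measurable
  \<comment> \<open>The \<open>t\<close> integral is a Gamma kernel with parameter
    \<open>v * r / (1 + v)\<close>. Its power \<open>- c\<close> lowers the exponent of
    \<open>v\<close> to \<open>\<beta> - c - 1\<close> and turns that of \<open>1 + v\<close> into
    \<open>c - n / 2\<close>, which is the Beta exponent.\<close>
  also have "\<dots> = (\<integral>\<^sup>+v. ennreal (pi powr (n / 2) * Gamma c * r powr (- c)) *
      ennreal (P (\<beta> - c) v * (1 + v) powr (- ((\<beta> - c) + (\<alpha> - c)))) \<partial>lborel)"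
  proof (rule nn_integral_cong)
    fix v :: real
    show "(\<integral>\<^sup>+t. ennreal (pi powr (n / 2) * P \<beta> v * (1 + v) powr (- (n / 2)) *
        (P c t * exp (- (t * (v * r / (1 + v)))))) \<partial>lborel) =
      ennreal (pi powr (n / 2) * Gamma c * r powr (- c)) *
      ennreal (P (\<beta> - c) v * (1 + v) powr (- ((\<beta> - c) + (\<alpha> - c))))"
    proof (cases "0 < v")
      case True
      have "(\<integral>\<^sup>+t. ennreal (pi powr (n / 2) * P \<beta> v * (1 + v) powr (- (n / 2)) *
          (P c t * exp (- (t * (v * r / (1 + v)))))) \<partial>lborel) =
        ennreal (pi powr (n / 2) * P \<beta> v * (1 + v) powr (- (n / 2))) *
          (\<integral>\<^sup>+t. ennreal (P c t * exp (- (t * (v * r / (1 + v))))) \<partial>lborel)"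
        by (subst nn_integral_cmult[symmetric]) (auto simp: ennreal_mult'[symmetric] P_nonneg)
      also have "\<dots> = ennreal (pi powr (n / 2) * P \<beta> v * (1 + v) powr (- (n / 2)) *
          (Gamma c * (v * r / (1 + v)) powr (- c)))"
        using True r pos by (subst gam) (auto simp: ennreal_mult'[symmetric] P_nonneg)
      also have "pi powr (n / 2) * P \<beta> v * (1 + v) powr (- (n / 2)) *
          (Gamma c * (v * r / (1 + v)) powr (- c)) =
        (pi powr (n / 2) * Gamma c * r powr (- c)) *
          ((v powr (\<beta> - 1) * v powr (- c)) * ((1 + v) powr (- (n / 2)) / (1 + v) powr (- c)))"
        using True r by (simp add: P_def powr_mult powr_divide)
      also have "v powr (\<beta> - 1) * v powr (- c) = P (\<beta> - c) v"
        using True by (simp add: P_def powr_add[symmetric] algebra_simps)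
      also have "(1 + v) powr (- (n / 2)) / (1 + v) powr (- c) = (1 + v) powr (- ((\<beta> - c) + (\<alpha> - c)))"
        using True by (simp add: powr_diff[symmetric] n algebra_simps)
      finally show ?thesis
        using pos by (simp add: ennreal_mult'[symmetric] P_nonneg less_imp_le Gamma_real_pos)
    qed (simp add: P_def)
  qed
  also have "\<dots> = ennreal (pi powr (n / 2) * Gamma c * r powr (- c)) *
      ennreal (Gamma (\<beta> - c) * Gamma (\<alpha> - c) / Gamma ((\<beta> - c) + (\<alpha> - c)))"
    using nn_integral_beta_kernel[of "\<beta> - c" "\<alpha> - c"] pos
    by (subst nn_integral_cmult) (simp_all add: P_def)
  also have "\<dots> = ennreal (G * (pi powr (n / 2) *
      (Gamma (\<beta> - c) * Gamma (\<alpha> - c) * Gamma c) / (Gamma \<alpha> * Gamma \<beta> * Gamma ((\<beta> - c) + (\<alpha> - c))) *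
      r powr (- c)))"
  proof -
    have "0 < Gamma \<alpha>" "0 < Gamma \<beta>" "0 < Gamma c"
      using pos by (auto intro!: Gamma_real_pos)
    thus ?thesis
      by (simp add: ennreal_mult'[symmetric] G_def mult_ac)
  qed
  finally have eq: "ennreal G * ?J = ennreal (G * (pi powr (n / 2) *
      (Gamma (\<beta> - c) * Gamma (\<alpha> - c) * Gamma c) / (Gamma \<alpha> * Gamma \<beta> * Gamma ((\<beta> - c) + (\<alpha> - c))) *
      r powr (- c)))" .
  have "?J = ennreal (1 / G * G) * ?J"
    using G by simp
  also have "\<dots> = ennreal (1 / G) * (ennreal G * ?J)"
    using G by (subst ennreal_mult') (simp_all add: mult.assoc)
  also have "\<dots> = ennreal (pi powr (n / 2) *
      (Gamma (\<beta> - c) * Gamma (\<alpha> - c) * Gamma c) / (Gamma \<alpha> * Gamma \<beta> * Gamma ((\<beta> - c) + (\<alpha> - c))) *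
      r powr (- c))"
    unfolding eq using G by (simp add: ennreal_mult'[symmetric])
  also have "r powr (- c) = norm x powr (n - a - b)"
  proof -
    have "- (2 * c) = n - a - b" by (simp add: c_def field_simps)
    thus ?thesis unfolding r_def norm_powr by simp
  qed
  also have "\<beta> - c = (n - a) / 2"
    by (simp add: \<beta>_def c_def field_simps)
  also have "\<alpha> - c = (n - b) / 2"
    by (simp add: \<alpha>_def c_def field_simps)
  also have "(n - a) / 2 + (n - b) / 2 = n - (a + b) / 2"
    by (simp add: field_simps)
  finally show ?thesis
    by (simp only: \<alpha>_def \<beta>_def c_def n_def)
qed

lemma riesz_gamma_pos:
  assumes "0 < \<alpha>" "\<alpha> < real N"
  shows "0 < riesz_gamma N \<alpha>"
  using assms by (simp add: riesz_gamma_def Gamma_real_pos)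

text \<open>Each \<open>riesz_gamma\<close> factor carries a power of 2 and
  \<open>pi powr (N / 2)\<close>. The powers of 2 cancel because
  \<open>(N - a) + (N - b) = 2 * N - (a + b)\<close>, and a single \<open>pi powr (N / 2)\<close>
  survives.\<close>

lemma nn_integral_riesz_composition:
  fixes a b :: real and x :: "'a::euclidean_space"
  assumes a: "0 < a" "a < DIM('a)" and b: "0 < b" "b < DIM('a)" and ab: "DIM('a) < a + b"
    and x: "x \<noteq> 0"
  shows "(\<integral>\<^sup>+y. ennreal (norm y powr (- a) * norm (x - y) powr (- b)) \<partial>lborel) =
    ennreal (riesz_gamma DIM('a) (DIM('a) - a) * riesz_gamma DIM('a) (DIM('a) - b) /
      riesz_gamma DIM('a) (2 * DIM('a) - (a + b)) * norm x powr (DIM('a) - a - b))"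
proof -
  define n where "n = real DIM('a)"
  have two: "2 powr (n - a) * 2 powr (n - b) = (2 powr (2 * n - (a + b)) :: real)"
    by (simp add: powr_add[symmetric] algebra_simps)
  have e: "(n - (2 * n - (a + b))) / 2 = (a + b - n) / 2" "(2 * n - (a + b)) / 2 = n - (a + b) / 2"
    by (simp_all add: field_simps)
  have pos: "0 < Gamma (a / 2)" "0 < Gamma (b / 2)" "0 < Gamma (n - (a + b) / 2)"
      "0 < Gamma ((a + b - n) / 2)"
    using a b ab by (auto intro!: Gamma_real_pos simp: n_def field_simps)
  have "riesz_gamma DIM('a) (n - a) * riesz_gamma DIM('a) (n - b) / riesz_gamma DIM('a) (2 * n - (a + b)) =
    (2 powr (n - a) * 2 powr (n - b)) / 2 powr (2 * n - (a + b)) * (pi powr (n / 2) *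
      (Gamma ((n - a) / 2) * Gamma ((n - b) / 2) * Gamma ((a + b - n) / 2)) /
      (Gamma (a / 2) * Gamma (b / 2) * Gamma (n - (a + b) / 2)))"
    unfolding riesz_gamma_def n_def[symmetric] e using pos by (simp add: field_simps)
  thus ?thesis
    using nn_integral_riesz_kernels[OF assms] by (simp add: two n_def[symmetric])
qed

section \<open>Derivatives and Laplacian of radial powers\<close>

text \<open>Writing the derivative with \<open>norm x powr (k - 2) * (x \<bullet> h)\<close> instead
  of \<open>sgn x\<close> leaves a radial power times a linear form, so the same rule applies again
  for second derivatives.\<close>

lemma has_derivative_norm_powr:
  fixes x :: "'a::euclidean_space"
  assumes "x \<noteq> 0"
  shows "((\<lambda>x. norm x powr k) has_derivative (\<lambda>h. k * norm x powr (k - 2) * (x \<bullet> h))) (at x)"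
proof -
  have "((\<lambda>x. norm x powr k) has_derivative
      (\<lambda>h. (norm x powr k) * (0 * ln (norm x) + (sgn x \<bullet> h) * k / norm x))) (at x)"
    using assms
    by (intro has_derivative_powr has_derivative_const)
       (use has_derivative_norm[OF assms] in \<open>simp_all add: inner_commute\<close>)
  moreover have "(norm x powr k) * (0 * ln (norm x) + (sgn x \<bullet> h) * k / norm x) =
      k * norm x powr (k - 2) * (x \<bullet> h)" for h
    using assms by (simp add: powr_diff sgn_div_norm powr_numeral power2_eq_square field_simps)
  ultimately show ?thesis by simp
qed

lemma partial_has_derivative:
  "(u has_derivative D) (at x) \<Longrightarrow> partial b u x = D b"
  unfolding partial_def by (metis frechet_derivative_at)

context
  fixes c k :: real and u :: "'a::euclidean_space \<Rightarrow> real"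
  defines "u \<equiv> (\<lambda>x. c * norm x powr k)"
begin

lemma radial_power_has_derivative:
  "x \<noteq> 0 \<Longrightarrow> (u has_derivative (\<lambda>h. c * k * norm x powr (k - 2) * (x \<bullet> h))) (at x)"
  unfolding u_def
  using has_derivative_mult_right[OF has_derivative_norm_powr, of x c k] by (simp add: mult.assoc)

lemma partial_radial_power:
  "x \<noteq> 0 \<Longrightarrow> partial b u x = c * k * norm x powr (k - 2) * (x \<bullet> b)"
  by (rule partial_has_derivative[OF radial_power_has_derivative])

lemma partial_radial_power_has_derivative:
  assumes "x \<noteq> 0"
  shows "(partial b u has_derivative
    (\<lambda>h. c * k * ((k - 2) * norm x powr (k - 4) * (x \<bullet> h) * (x \<bullet> b) + norm x powr (k - 2) * (h \<bullet> b)))) (at x)"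
\<comment> \<open>The formula for \<open>partial b u\<close> is known only off the origin, so its
  derivative is transferred on the open set \<open>- {0}\<close>.\<close>
proof (rule has_derivative_transform_within_open)
  show "((\<lambda>x. c * k * norm x powr (k - 2) * (x \<bullet> b)) has_derivative
    (\<lambda>h. c * k * ((k - 2) * norm x powr (k - 4) * (x \<bullet> h) * (x \<bullet> b) + norm x powr (k - 2) * (h \<bullet> b)))) (at x)"
    by (rule has_derivative_eq_rhs, rule has_derivative_mult,
        rule has_derivative_mult_right[OF has_derivative_norm_powr[OF assms]],
        rule has_derivative_inner_left[OF has_derivative_ident]) (simp add: algebra_simps)
  show "open (- {0::'a})" "x \<in> - {0}" using assms by auto
qed (simp add: partial_radial_power)

lemma partial_partial_radial_power:
  "x \<noteq> 0 \<Longrightarrow> partial b' (partial b u) x =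
    c * k * ((k - 2) * norm x powr (k - 4) * (x \<bullet> b') * (x \<bullet> b) + norm x powr (k - 2) * (b' \<bullet> b))"
  by (rule partial_has_derivative[OF partial_radial_power_has_derivative])

lemma C2_on_radial_power: "C2_on (UNIV - {0}) u"
proof -
  have "continuous_on (UNIV - {0}) (partial b u)" for b
    by (subst continuous_on_cong[OF refl partial_radial_power]) (auto intro!: continuous_intros)
  moreover have "continuous_on (UNIV - {0}) (partial b' (partial b u))" for b b'
    by (subst continuous_on_cong[OF refl partial_partial_radial_power]) (auto intro!: continuous_intros)
  ultimately show ?thesis
    unfolding C2_on_def C1_on_def
    using radial_power_has_derivative partial_radial_power_has_derivative by (auto simp: differentiable_def) blast+
qed

text \<open>In the trace of the second derivatives, the products
  \<open>(x \<bullet> b) * (x \<bullet> b)\<close> sum to the squared norm and the diagonal terms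
  contribute the dimension. For \<open>k = - s\<close> the constant is
  \<open>- (c * s * (N - 2 - s))\<close>.\<close>

lemma laplacian_radial_power:
  assumes "x \<noteq> 0"
  shows "laplacian u x = c * k * (k - 2 + DIM('a)) * norm x powr (k - 2)"
proof -
  have "laplacian u x = c * k * ((k - 2) * norm x powr (k - 4) * (\<Sum>b\<in>Basis. (x \<bullet> b) * (x \<bullet> b))
      + norm x powr (k - 2) * DIM('a))"
    using assms
    by (simp add: laplacian_def partial_partial_radial_power sum_distrib_left[symmetric] sum.distrib mult.assoc)
  also have "(\<Sum>b\<in>Basis. (x \<bullet> b) * (x \<bullet> b)) = norm x powr 2"
    using assms by (simp add: euclidean_inner[symmetric] power2_norm_eq_inner powr_numeral)
  also have "(k - 2) * norm x powr (k - 4) * norm x powr 2 = (k - 2) * norm x powr (k - 2)"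
    unfolding mult.assoc powr_add[symmetric] by simp
  finally show ?thesis
    by (simp add: algebra_simps)
qed

end

section \<open>The singular solution\<close>

lemma singular_at_origin_radial_power:
  fixes A s :: real
  assumes "0 < A" "0 < s"
  shows "singular_at_origin (\<lambda>x::'a::euclidean_space. A / norm x powr s)"
  unfolding singular_at_origin_def
proof (rule filterlim_compose[where g = "\<lambda>t. A / t powr s" and f = norm])
  show "filterlim norm (at_right 0) (at (0::'a))"
    by (auto simp: filterlim_at intro!: tendsto_eq_intros eventually_mono[OF eventually_neq_at_within])
  show "filterlim (\<lambda>t. A / t powr s) at_top (at_right 0)"
    using assms by real_asymp
qed

text \<open>Under the other bounds, \<open>s\<close> and the three \<open>riesz_gamma\<close> values
  are positive, so \<open>K_pos\<close> amounts to \<open>s < N - 2\<close>, the condition for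
  \<open>- laplacian u\<close> to be positive.\<close>

theorem theorem1p2:
  fixes \<mu> p q s K :: real and N :: nat
  assumes N: "N = CARD('n::finite)"
    and mu: "0 < \<mu>" "\<mu> < real N"
    and pq: "1 \<le> p" "1 \<le> q"
    and s: "s = (real N - \<mu> + 2) / (p + q - 1)"
    and K: "K = s * (real N - 2 - s) * riesz_gamma N (real N - 2 + s * (q - 1)) /
                (riesz_gamma N (real N - \<mu>) * riesz_gamma N (real N - s * p))"
    and K_pos: "0 < K"
    and sp: "0 < s * p" "s * p < real N"
    and sq: "2 - real N < s * (q - 1)" "s * (q - 1) < 2"
  shows "0 < s \<and>
    (\<exists>A>0. A powr (p + q - 1) = K \<and>
      (let u = (\<lambda>x::real^'n. A / norm x powr s) in
         radially_symmetric u \<and> positive_off_origin u \<and> singular_at_origin u \<and>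
         choquard_solution \<mu> p q u))"
proof -
  have s_pos: "0 < s" using mu pq unfolding s by simp
  \<comment> \<open>The scaling relation: it gives
    \<open>N - s * p - \<mu> - s * q = - s - 2\<close>, so both sides of the equation have the same
    homogeneity.\<close>
  have s_eq: "s * p + s * (q - 1) = real N - \<mu> + 2"
  proof -
    have "s * (p + q - 1) = real N - \<mu> + 2"
      using pq unfolding s by simp
    thus ?thesis by (simp add: algebra_simps)
  qed
  define A where "A = K powr (1 / (p + q - 1))"
  have A_pos: "0 < A" using K_pos by (simp add: A_def)
  have A_powr: "A powr (p + q - 1) = K"
    using pq K_pos by (simp add: A_def powr_powr)
  define u where "u = (\<lambda>x::real^'n. A / norm x powr s)"
  have u_eq: "u = (\<lambda>x. A * norm x powr (- s))"
    by (simp add: u_def powr_minus_divide)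
  \<comment> \<open>The composition constant for \<open>a = s * p\<close> and
    \<open>b = \<mu>\<close>; by \<open>s_eq\<close>, \<open>2 * N - (a + b)\<close> is
    \<open>N - 2 + s * (q - 1)\<close>. \<open>K\<close> is chosen so that \<open>K * C\<close> is
    the Laplacian constant \<open>s * (N - 2 - s)\<close>.\<close>
  define C where "C = riesz_gamma N (real N - s * p) * riesz_gamma N (real N - \<mu>) /
    riesz_gamma N (real N - 2 + s * (q - 1))"
  have C_pos: "0 < C"
    unfolding C_def using mu sp sq s_pos pq
    by (intro divide_pos_pos mult_pos_pos riesz_gamma_pos) auto
  have KC: "K * C = s * (real N - 2 - s)"
    using K_pos unfolding K C_def by (auto simp: mult.commute)
  have "choquard_solution \<mu> p q u"
    unfolding choquard_solution_def
  proof (intro conjI ballI)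
    show "C2_on (UNIV - {0}) u"
      unfolding u_eq by (rule C2_on_radial_power)
  next
    fix x :: "real^'n" assume "x \<in> UNIV - {0}"
    hence x: "x \<noteq> 0" by simp
    define I where "I = A powr p * (C * norm x powr (real N - s * p - \<mu>))"
    define f where "f = (\<lambda>y. indicator (UNIV - {0}) y *\<^sub>R (\<bar>u y\<bar> powr p / norm (x - y) powr \<mu>))"
    \<comment> \<open>This holds at every \<open>y\<close>: at \<open>y = 0\<close> the indicator
      and \<open>0 powr (- (s * p))\<close> both vanish, and at \<open>y = x\<close> division by
      zero and \<open>0 powr (- \<mu>)\<close> both give \<open>0\<close>.\<close>
    have f_eq: "f y = A powr p * (norm y powr (- (s * p)) * norm (x - y) powr (- \<mu>))" for y
      using A_pos by (cases "y = 0") (simp_all add: f_def u_eq powr_mult powr_powr powr_minus_divide[of "norm (x - y)"])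
    have "(\<integral>\<^sup>+y. ennreal (f y) \<partial>lborel) = ennreal (A powr p) *
        (\<integral>\<^sup>+y. ennreal (norm y powr (- (s * p)) * norm (x - y) powr (- \<mu>)) \<partial>lborel)"
      unfolding f_eq by (subst nn_integral_cmult[symmetric]) (auto simp: ennreal_mult'[symmetric])
    also have "(\<integral>\<^sup>+y. ennreal (norm y powr (- (s * p)) * norm (x - y) powr (- \<mu>)) \<partial>lborel) =
        ennreal (C * norm x powr (real N - s * p - \<mu>))"
    proof -
      have "real N - 2 + s * (q - 1) = 2 * real N - (s * p + \<mu>)"
        using s_eq by simp
      thus ?thesis
        unfolding C_def \<open>real N - 2 + s * (q - 1) = 2 * real N - (s * p + \<mu>)\<close>
        using nn_integral_riesz_composition[of "s * p" \<mu> x] x mu sp sq s_eq by (simp only: N[symmetric] DIM_cart DIM_real mult_1_right) simp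
    qed
    finally have "(\<integral>\<^sup>+y. ennreal (f y) \<partial>lborel) = ennreal I"
      by (simp add: I_def ennreal_mult')
    moreover have "f \<in> borel_measurable lborel"
      unfolding f_eq[abs_def] by measurable
    \<comment> \<open>For a nonnegative measurable function, a finite \<open>nn_integral\<close>
      yields both integrability and the value of the Bochner integral.\<close>
    ultimately have "has_bochner_integral lborel f I"
      using C_pos by (intro has_bochner_integral_nn_integral) (auto simp: I_def f_eq)
    hence f: "integrable lborel f" "integral\<^sup>L lborel f = I"
      by (simp_all add: has_bochner_integral_iff)
    show "set_integrable lborel (UNIV - {0}) (\<lambda>y. \<bar>u y\<bar> powr p / norm (x - y) powr \<mu>)"
      using f unfolding set_integrable_def f_def by simp
    have "(LINT y:UNIV - {0}|lborel. \<bar>u y\<bar> powr p / norm (x - y) powr \<mu>) = I"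
      using f unfolding set_lebesgue_integral_def f_def by simp
    hence "(LINT y:UNIV - {0}|lborel. \<bar>u y\<bar> powr p / norm (x - y) powr \<mu>) * \<bar>u x\<bar> powr q =
        (A powr p * A powr q) * C * (norm x powr (real N - s * p - \<mu>) * norm x powr (- (s * q)))"
      using A_pos x by (simp add: I_def u_eq powr_mult powr_powr)
    \<comment> \<open>One factor \<open>A\<close> is split off for the left side of the equation;
      the remaining \<open>A powr (p + q - 1)\<close> is \<open>K\<close>.\<close>
    also have "A powr p * A powr q = A * K"
      using A_pos by (simp add: A_powr[symmetric] powr_add[symmetric] powr_mult_base)
    also have "A * K * C = A * s * (real N - 2 - s)"
      using KC by (simp add: mult.assoc)
    also have "norm x powr (real N - s * p - \<mu>) * norm x powr (- (s * q)) = norm x powr (- s - 2)"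
      using s_eq by (simp add: powr_add[symmetric] algebra_simps)
    also have "A * s * (real N - 2 - s) * norm x powr (- s - 2) = - laplacian u x"
      unfolding u_eq laplacian_radial_power[OF x] by (simp add: N algebra_simps)
    finally show "- laplacian u x =
        (LINT y:UNIV - {0}|lborel. \<bar>u y\<bar> powr p / norm (x - y) powr \<mu>) * \<bar>u x\<bar> powr q" ..
  qed
  moreover have "radially_symmetric u" "positive_off_origin u"
    using A_pos by (auto simp: u_def radially_symmetric_def positive_off_origin_def)
  moreover have "singular_at_origin u"
    unfolding u_def by (rule singular_at_origin_radial_power[OF A_pos s_pos])
  ultimately show ?thesis
    using s_pos A_pos A_powr unfolding u_def Let_def by blast
qed

end
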